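(* Let $p$ be a prime, let $f\in\mathrm{Aut}(\mathbb{Z}_p)$, and let $Q=\mathrm{Aff}(\mathbb{Z}_p,f)$ be a connected quandle. Suppose that the integral quandle ring $\mathbb{Z}[Q]$ has a nontrivial idempotent $u$ with augmentation $\varepsilon(u)=1$. Then $\mathbb{Z}[Q]$ has infinitely many nontrivial idempotents.
   Context: For an additive abelian group $A$ and $f\in\mathrm{Aut}(A)$, the affine quandle $\mathrm{Aff}(A,f)$ is the set $A$ with the operation $x\triangleright y=f(x)+(1-f)(y)$, where $1$ denotes the identity map. For $A=\mathbb{Z}_p=\mathbb{Z}/p\mathbb{Z}$ we have $f(x)=tx$ for some $t\in\mathbb{Z}_p^*$, so that $x\triangleright y=tx+(1-t)y$. A quandle $Q$ is connected if the group generated by the maps $R_x:Q\to Q$, $R_x(y)=y\triangleright x$ ($x\in Q$), acts transitively on $Q$; for $\mathrm{Aff}(\mathbb{Z}_p,f)$ with $p$ prime this is equivalent to $1-t\neq 0$ in $\mathbb{Z}_p$. The integral quandle ring $\mathbb{Z}[Q]$ is the (in general nonassociative) ring whose additive group is the free $\mathbb{Z}$-module with basis $\{e_x : x\in Q\}$, with multiplication given by bilinear extension of $e_xe_y=e_{x\triangleright y}$. The augmentation map is the ring homomorphism $\varepsilon:\mathbb{Z}[Q]\to\mathbb{Z}$, $\sum_x a_xe_x\mapsto\sum_x a_x$. An idempotent is an element $u$ with $u^2=u$; it is trivial if it is $0$ or equal to $e_x$ for some $x\in Q$, and nontrivial otherwise. *)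

theory Defs
  imports
    "HOL-Algebra.Algebra"
    "HOL-Library.Poly_Mapping"
    "HOL-Computational_Algebra.Primes"
begin

record 'a quandle = "'a partial_object" +
  qop :: "'a \<Rightarrow> 'a \<Rightarrow> 'a"  (infixl "\<triangleright>\<index>" 70)

definition right_translation :: "('a, 'm) quandle_scheme \<Rightarrow> 'a \<Rightarrow> 'a \<Rightarrow> 'a"
  where "right_translation Q x = (\<lambda>y \<in> carrier Q. y \<triangleright>\<^bsub>Q\<^esub> x)"

locale quandle =
  fixes Q (structure)
  assumes closed: "\<lbrakk>x \<in> carrier Q; y \<in> carrier Q\<rbrakk> \<Longrightarrow> x \<triangleright> y \<in> carrier Q"
    and idem: "x \<in> carrier Q \<Longrightarrow> x \<triangleright> x = x"
    and bij: "x \<in> carrier Q \<Longrightarrow> right_translation Q x \<in> Bij (carrier Q)"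
    and distrib: "\<lbrakk>x \<in> carrier Q; y \<in> carrier Q; z \<in> carrier Q\<rbrakk>
      \<Longrightarrow> (x \<triangleright> y) \<triangleright> z = (x \<triangleright> z) \<triangleright> (y \<triangleright> z)"

definition inner_group :: "('a, 'm) quandle_scheme \<Rightarrow> ('a \<Rightarrow> 'a) monoid"
  where "inner_group Q = (BijGroup (carrier Q))
    \<lparr>carrier := generate (BijGroup (carrier Q)) (right_translation Q ` carrier Q)\<rparr>"

locale connected_quandle = quandle +
  assumes transitive: "transitive_action (inner_group Q) (carrier Q) (\<lambda>g. g)"

text \<open>The group \<open>A\<close> is abelian but written multiplicatively, as everywhere in HOL-Algebra:
  \<open>x \<triangleright> y = f(x) + (y - f(y))\<close>.\<close>

definition affine_quandle :: "('a, 'm) monoid_scheme \<Rightarrow> ('a \<Rightarrow> 'a) \<Rightarrow> 'a quandle"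
  where "affine_quandle A f =
    \<lparr>carrier = carrier A, qop = (\<lambda>x y. f x \<otimes>\<^bsub>A\<^esub> (y \<otimes>\<^bsub>A\<^esub> inv\<^bsub>A\<^esub> (f y)))\<rparr>"

text \<open>The additive group of the integral quandle ring is the free abelian group on the carrier,
  with basis elements \<open>frag_of x\<close>. The product has to be defined separately: the
  multiplication that the type of finitely supported functions carries as a type class instance
  is convolution with respect to addition on the index type.\<close>

definition quandle_ring_carrier :: "('a, 'm) quandle_scheme \<Rightarrow> ('a \<Rightarrow>\<^sub>0 int) set"
  where "quandle_ring_carrier Q = carrier (free_Abelian_group (carrier Q))"

definition quandle_ring_mult ::
    "('a, 'm) quandle_scheme \<Rightarrow> ('a \<Rightarrow>\<^sub>0 int) \<Rightarrow> ('a \<Rightarrow>\<^sub>0 int) \<Rightarrow> ('a \<Rightarrow>\<^sub>0 int)"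
  where "quandle_ring_mult Q u v =
    frag_extend (\<lambda>x. frag_extend (\<lambda>y. frag_of (x \<triangleright>\<^bsub>Q\<^esub> y)) v) u"

definition augmentation :: "('a \<Rightarrow>\<^sub>0 int) \<Rightarrow> int"
  where "augmentation u = (\<Sum>x \<in> Poly_Mapping.keys u. Poly_Mapping.lookup u x)"

definition quandle_ring_idempotent :: "('a, 'm) quandle_scheme \<Rightarrow> ('a \<Rightarrow>\<^sub>0 int) \<Rightarrow> bool"
  where "quandle_ring_idempotent Q u \<longleftrightarrow>
    u \<in> quandle_ring_carrier Q \<and> quandle_ring_mult Q u u = u"

definition trivial_idempotent :: "('a, 'm) quandle_scheme \<Rightarrow> ('a \<Rightarrow>\<^sub>0 int) \<Rightarrow> bool"
  where "trivial_idempotent Q u \<longleftrightarrow> u = 0 \<or> (\<exists>x \<in> carrier Q. u = frag_of x)"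

definition nontrivial_idempotent :: "('a, 'm) quandle_scheme \<Rightarrow> ('a \<Rightarrow>\<^sub>0 int) \<Rightarrow> bool"
  where "nontrivial_idempotent Q u \<longleftrightarrow>
    quandle_ring_idempotent Q u \<and> \<not> trivial_idempotent Q u"

lemma quandle_ring_mult_basis:
  "quandle_ring_mult Q (frag_of x) (frag_of y) = frag_of (x \<triangleright>\<^bsub>Q\<^esub> y)"
  by (simp add: quandle_ring_mult_def)

lemma (in comm_group) affine_distrib_cancel:
  assumes "a \<in> carrier G" "b \<in> carrier G" "b' \<in> carrier G" "c \<in> carrier G" "c' \<in> carrier G"
    "z \<in> carrier G"
  shows "a \<otimes> (b \<otimes> inv b') \<otimes> (z \<otimes> inv c) =
    a \<otimes> (c \<otimes> inv c') \<otimes> (b \<otimes> (z \<otimes> inv c) \<otimes> inv (b' \<otimes> (c \<otimes> inv c')))"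
proof -
  have shuffle: "a \<otimes> d \<otimes> (b \<otimes> e \<otimes> (i \<otimes> j)) = a \<otimes> (b \<otimes> i) \<otimes> e \<otimes> (d \<otimes> j)"
    if "d \<in> carrier G" "e \<in> carrier G" "i \<in> carrier G" "j \<in> carrier G" for d e i j
    using that assms(1,2) by (simp add: m_ac)
  define d where "d = c \<otimes> inv c'"
  define e where "e = z \<otimes> inv c"
  have de: "d \<in> carrier G" "e \<in> carrier G" using assms by (simp_all add: d_def e_def)
  have "a \<otimes> d \<otimes> (b \<otimes> e \<otimes> inv (b' \<otimes> d)) = a \<otimes> d \<otimes> (b \<otimes> e \<otimes> (inv b' \<otimes> inv d))"
    using assms(3) de by (simp add: inv_mult)
  also have "\<dots> = a \<otimes> (b \<otimes> inv b') \<otimes> e \<otimes> (d \<otimes> inv d)"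
    using assms(3) de by (intro shuffle) simp_all
  also have "\<dots> = a \<otimes> (b \<otimes> inv b') \<otimes> e"
    using assms(1-3) de by simp
  finally show ?thesis by (simp only: d_def e_def)
qed

lemma quandle_affine_quandle:
  assumes "comm_group A" and f: "f \<in> auto A"
  shows "quandle (affine_quandle A f)"
proof -
  interpret comm_group A by fact
  interpret group_hom A A f
    using f by unfold_locales (simp add: auto_def)
  have bij_f: "bij_betw f (carrier A) (carrier A)"
    using f by (simp add: auto_def Bij_def)
  show ?thesis
  proof (unfold_locales, goal_cases)
    case (1 x y)
    then show ?case by (simp add: affine_quandle_def)
  next
    case (2 x)
    then show ?case by (simp add: affine_quandle_def m_lcomm)
  next
    case (3 x)
    then have x: "x \<in> carrier A" by (simp add: affine_quandle_def)
    define c where "c = x \<otimes>\<^bsub>A\<^esub> inv\<^bsub>A\<^esub> (f x)"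
    have c: "c \<in> carrier A" using x by (simp add: c_def)
    have "bij_betw (\<lambda>y. y \<otimes>\<^bsub>A\<^esub> c) (carrier A) (carrier A)"
      by (rule bij_betwI[where g = "\<lambda>y. y \<otimes>\<^bsub>A\<^esub> inv\<^bsub>A\<^esub> c"]) (use c in \<open>auto simp: m_assoc\<close>)
    from bij_betw_trans[OF bij_f this]
    have "bij_betw (\<lambda>y. f y \<otimes>\<^bsub>A\<^esub> c) (carrier A) (carrier A)"
      by (simp add: o_def)
    then show ?case
      by (auto simp: Bij_def right_translation_def affine_quandle_def c_def
          cong: bij_betw_cong)
  next
    case (4 x y z)
    then show ?case
      by (simp add: affine_quandle_def) (rule affine_distrib_cancel; simp)
  qed
qed

lemma (in quandle) connected_quandle_iff:
  "connected_quandle Q \<longleftrightarrow>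
    (\<forall>x \<in> carrier Q. \<forall>y \<in> carrier Q.
      \<exists>g \<in> generate (BijGroup (carrier Q)) (right_translation Q ` carrier Q). g x = y)"
proof -
  let ?B = "BijGroup (carrier Q)"
  interpret B: group ?B by (rule group_BijGroup)
  have sub: "subgroup (carrier (inner_group Q)) ?B"
    unfolding inner_group_def
    by simp (rule B.generate_is_subgroup, use bij in \<open>auto simp: BijGroup_def\<close>)
  have "group_hom (inner_group Q) ?B (\<lambda>g. g)"
  proof (rule group_hom.intro)
    show "group (inner_group Q)"
      using B.subgroup_imp_group[OF sub] by (simp add: inner_group_def)
    show "group_hom_axioms (inner_group Q) ?B (\<lambda>g. g)"
      using subgroup.subset[OF sub]
      by (auto simp: group_hom_axioms_def hom_def inner_group_def)
  qed (rule group_BijGroup)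
  then show ?thesis
    using quandle_axioms
    by (auto simp: connected_quandle_def connected_quandle_axioms_def transitive_action_def
        transitive_action_axioms_def group_action_def inner_group_def)
qed

end

theory Submission
  imports Defs
begin

text \<open>
  Over an abelian group \<open>A\<close>, the affine product on \<open>\<int>[A]\<close> satisfies the interchange law
  \<open>(ab) \<triangleright> (cd) = (a \<triangleright> c)(b \<triangleright> d)\<close> with respect to the group ring product, so the group ring square
  of an idempotent is again an idempotent. Let \<open>N(a) = \<Sum> a\<^sub>x\<^sup>2\<close> and let \<open>a\<^sup>*\<close> be the image of \<open>a\<close>
  under inversion. Then \<open>N(a\<^sup>2) = N(a a\<^sup>*)\<close>, and the coefficient of \<open>a a\<^sup>*\<close> at the neutral element
  is \<open>N(a)\<close>; hence \<open>N(a\<^sup>2) \<ge> N(a)\<^sup>2\<close>. An element of augmentation 1 that is not a basis element has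
  \<open>N \<ge> 2\<close>, so repeated squaring yields idempotents of unbounded \<open>N\<close>, whereas trivial idempotents
  have \<open>N \<le> 1\<close>.
\<close>

section \<open>Bilinear products on the free abelian group\<close>

text \<open>The operation \<open>m\<close> is a parameter so that the quandle ring product, the
  group ring product and the pairing \<open>x \<otimes> inv y\<close>, which gives a
  \<open>b\<^sup>*\<close>, are all instances.\<close>

definition bilinear_extension ::
    "('a \<Rightarrow> 'a \<Rightarrow> 'a) \<Rightarrow> ('a \<Rightarrow>\<^sub>0 int) \<Rightarrow> ('a \<Rightarrow>\<^sub>0 int) \<Rightarrow> ('a \<Rightarrow>\<^sub>0 int)"
  where "bilinear_extension m a b = frag_extend (\<lambda>x. frag_extend (\<lambda>y. frag_of (m x y)) b) a"

lemma quandle_ring_mult_eq: "quandle_ring_mult Q = bilinear_extension (qop Q)"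
  by (simp add: fun_eq_iff quandle_ring_mult_def bilinear_extension_def)

lemma bilinear_extension_of [simp]:
  "bilinear_extension m (frag_of x) (frag_of y) = frag_of (m x y)"
  by (simp add: bilinear_extension_def)

lemma bilinear_extension_0 [simp]:
  "bilinear_extension m 0 b = 0" "bilinear_extension m a 0 = 0"
  by (simp_all add: bilinear_extension_def frag_extend_eq_0)

lemma bilinear_extension_diff_left:
  "bilinear_extension m (a - a') b = bilinear_extension m a b - bilinear_extension m a' b"
  by (simp add: bilinear_extension_def frag_extend_diff)

lemma bilinear_extension_diff_right:
  "bilinear_extension m a (b - b') = bilinear_extension m a b - bilinear_extension m a b'"
  \<comment> \<open>The extension in \<open>b\<close> sits inside the one in \<open>a\<close>, so
    additivity in \<open>b\<close> is first reduced to basis elements \<open>a\<close>.\<close>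
  by (induction a rule: frag_induction[OF subset_UNIV])
    (simp_all add: bilinear_extension_diff_left,
     simp add: bilinear_extension_def frag_extend_diff)

lemmas bilinear_extension_diff = bilinear_extension_diff_left bilinear_extension_diff_right

lemma keys_bilinear_extension_subset:
  assumes "Poly_Mapping.keys a \<subseteq> S" "Poly_Mapping.keys b \<subseteq> S"
    and closed: "\<And>x y. \<lbrakk>x \<in> S; y \<in> S\<rbrakk> \<Longrightarrow> m x y \<in> S"
  shows "Poly_Mapping.keys (bilinear_extension m a b) \<subseteq> S"
  using assms(1)
proof (induction a rule: frag_induction)
  case (one x)
  show ?case
    using assms(2)
  proof (induction b rule: frag_induction)
    case (diff a b)
    then show ?case
      using keys_diff[of "bilinear_extension m (frag_of x) a" "bilinear_extension m (frag_of x) b"]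
      by (auto simp: bilinear_extension_diff)
  qed (use one closed in auto)
next
  case (diff a a')
  then show ?case
    using keys_diff[of "bilinear_extension m a b" "bilinear_extension m a' b"]
    by (auto simp: bilinear_extension_diff)
qed auto

text \<open>Multilinear induction: an identity between two expressions additive in each of four
  arguments has to be checked on basis elements only.\<close>

lemma frag_induction4:
  assumes "Poly_Mapping.keys a \<subseteq> S" "Poly_Mapping.keys b \<subseteq> S"
    "Poly_Mapping.keys c \<subseteq> S" "Poly_Mapping.keys d \<subseteq> S"
    and of: "\<And>x y z w. \<lbrakk>x \<in> S; y \<in> S; z \<in> S; w \<in> S\<rbrakk> \<Longrightarrow>
      P (frag_of x) (frag_of y) (frag_of z) (frag_of w)"
    and zero: "\<And>b c d. P 0 b c d" "\<And>a c d. P a 0 c d" "\<And>a b d. P a b 0 d" "\<And>a b c. P a b c 0"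
    and diff: "\<And>a a' b c d. \<lbrakk>P a b c d; P a' b c d\<rbrakk> \<Longrightarrow> P (a - a') b c d"
      "\<And>a b b' c d. \<lbrakk>P a b c d; P a b' c d\<rbrakk> \<Longrightarrow> P a (b - b') c d"
      "\<And>a b c c' d. \<lbrakk>P a b c d; P a b c' d\<rbrakk> \<Longrightarrow> P a b (c - c') d"
      "\<And>a b c d d'. \<lbrakk>P a b c d; P a b c d'\<rbrakk> \<Longrightarrow> P a b c (d - d')"
  shows "P a b c d"
proof -
  have 1: "P (frag_of x) (frag_of y) (frag_of z) d" if "x \<in> S" "y \<in> S" "z \<in> S" for x y z
    using assms(4) by (induction d rule: frag_induction) (blast intro: that of zero diff)+
  have 2: "P (frag_of x) (frag_of y) c d" if "x \<in> S" "y \<in> S" for x y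
    using assms(3) by (induction c rule: frag_induction) (blast intro: that 1 zero diff)+
  have 3: "P (frag_of x) b c d" if "x \<in> S" for x
    using assms(2) by (induction b rule: frag_induction) (blast intro: that 2 zero diff)+
  show ?thesis
    using assms(1) by (induction a rule: frag_induction) (blast intro: 3 zero diff)+
qed

lemma bilinear_extension_interchange:
  assumes "Poly_Mapping.keys a \<subseteq> S" "Poly_Mapping.keys b \<subseteq> S"
    "Poly_Mapping.keys c \<subseteq> S" "Poly_Mapping.keys d \<subseteq> S"
    and "\<And>x y z w. \<lbrakk>x \<in> S; y \<in> S; z \<in> S; w \<in> S\<rbrakk> \<Longrightarrow> m (n x y) (n z w) = n (m x z) (m y w)"
  shows "bilinear_extension m (bilinear_extension n a b) (bilinear_extension n c d) =
    bilinear_extension n (bilinear_extension m a c) (bilinear_extension m b d)"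
  using assms(1-4)
  by (rule frag_induction4) (simp_all add: assms(5) bilinear_extension_diff)

section \<open>The inner product and the norm N\<close>

text \<open>The inner product that makes the basis orthonormal, so that N(a) is
  \<open>frag_inner a a\<close>. Keys of \<open>b\<close> outside those of \<open>a\<close> would
  contribute 0.\<close>

definition frag_inner :: "('a \<Rightarrow>\<^sub>0 int) \<Rightarrow> ('a \<Rightarrow>\<^sub>0 int) \<Rightarrow> int"
  where "frag_inner a b = (\<Sum>x \<in> Poly_Mapping.keys a. Poly_Mapping.lookup a x * Poly_Mapping.lookup b x)"

text \<open>Allows elements with different supports to be compared over one common finite index
  set.\<close>

lemma frag_inner_superset:
  assumes "finite K" "Poly_Mapping.keys a \<subseteq> K"
  shows "frag_inner a b = (\<Sum>x \<in> K. Poly_Mapping.lookup a x * Poly_Mapping.lookup b x)"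
  unfolding frag_inner_def
  by (rule sum.mono_neutral_left) (use assms in \<open>auto simp: in_keys_iff\<close>)

lemma frag_inner_0 [simp]: "frag_inner 0 b = 0" "frag_inner a 0 = 0"
  by (simp_all add: frag_inner_def)

lemma frag_inner_of [simp]: "frag_inner (frag_of x) (frag_of y) = (if x = y then 1 else 0)"
  by (simp add: frag_inner_def lookup_frag_of)

lemma frag_inner_diff:
  "frag_inner (a - a') b = frag_inner a b - frag_inner a' b"
  "frag_inner a (b - b') = frag_inner a b - frag_inner a b'"
proof -
  let ?K = "Poly_Mapping.keys a \<union> Poly_Mapping.keys a'"
  have "Poly_Mapping.keys (a - a') \<subseteq> ?K"
    by (rule keys_diff)
  then show "frag_inner (a - a') b = frag_inner a b - frag_inner a' b"
    by (simp add: frag_inner_superset[of ?K] lookup_minus left_diff_distrib sum_subtractf)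
  show "frag_inner a (b - b') = frag_inner a b - frag_inner a b'"
    by (simp add: frag_inner_def lookup_minus right_diff_distrib sum_subtractf)
qed

lemma lookup_power2_le_frag_inner: "(Poly_Mapping.lookup a x)\<^sup>2 \<le> frag_inner a a"
proof (cases "x \<in> Poly_Mapping.keys a")
  case True
  then show ?thesis
    unfolding frag_inner_def power2_eq_square
    by (intro member_le_sum[where f = "\<lambda>x. Poly_Mapping.lookup a x * Poly_Mapping.lookup a x"]) auto
next
  case False
  then show ?thesis
    by (simp add: in_keys_iff frag_inner_def sum_nonneg)
qed

text \<open>A nonzero integer coefficient has square at least 1.\<close>

lemma card_keys_le_frag_inner: "int (card (Poly_Mapping.keys a)) \<le> frag_inner a a"
proof -
  have "(\<Sum>x \<in> Poly_Mapping.keys a. 1) \<le> frag_inner a a"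
    unfolding frag_inner_def
  proof (rule sum_mono)
    fix x assume "x \<in> Poly_Mapping.keys a"
    then have "Poly_Mapping.lookup a x * Poly_Mapping.lookup a x > 0"
      by (auto simp: in_keys_iff zero_less_mult_iff)
    then show "1 \<le> Poly_Mapping.lookup a x * Poly_Mapping.lookup a x" by simp
  qed
  then show ?thesis by simp
qed

text \<open>If N(a) < 2, the support has at most one point; augmentation 1 rules out the empty
  support and forces the single coefficient to be 1.\<close>

lemma frag_inner_ge_2_if_augmentation_1:
  assumes "augmentation a = 1" and "\<And>x. x \<in> Poly_Mapping.keys a \<Longrightarrow> a \<noteq> frag_of x"
  shows "frag_inner a a \<ge> 2"
proof (rule ccontr)
  assume "\<not> ?thesis"
  then have "card (Poly_Mapping.keys a) \<le> Suc 0"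
    using card_keys_le_frag_inner[of a] by simp
  moreover have "Poly_Mapping.keys a \<noteq> {}"
    using assms(1) by (auto simp: augmentation_def)
  ultimately obtain x where x: "Poly_Mapping.keys a = {x}"
    unfolding card_le_Suc0_iff_eq[OF finite_keys] by blast
  have "a = frag_of x"
  proof (rule poly_mapping_eqI)
    fix y
    show "Poly_Mapping.lookup a y = Poly_Mapping.lookup (frag_of x) y"
      using assms(1) x in_keys_iff[of y a] by (auto simp: augmentation_def lookup_frag_of)
  qed
  then show False using assms(2) x by simp
qed

section \<open>The group ring of an abelian group\<close>

context comm_group
begin

text \<open>The polarized form of N(\<open>a\<^sup>2\<close>) = N(a \<open>a\<^sup>*\<close>).
  Having four independent arguments makes it multilinear, and on basis elements it says that xy = zw
  iff x/z = w/y.\<close>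

lemma frag_inner_mult_eq:
  assumes "Poly_Mapping.keys a \<subseteq> carrier G" "Poly_Mapping.keys b \<subseteq> carrier G"
    "Poly_Mapping.keys c \<subseteq> carrier G" "Poly_Mapping.keys d \<subseteq> carrier G"
  shows "frag_inner (bilinear_extension (\<otimes>) a b) (bilinear_extension (\<otimes>) c d) =
    frag_inner (bilinear_extension (\<lambda>x y. x \<otimes> inv y) a c) (bilinear_extension (\<lambda>x y. x \<otimes> inv y) d b)"
  using assms
proof (rule frag_induction4)
  fix x y z w
  assume xyzw: "x \<in> carrier G" "y \<in> carrier G" "z \<in> carrier G" "w \<in> carrier G"
  have "x \<otimes> y = z \<otimes> w \<longleftrightarrow> x = z \<otimes> w \<otimes> inv y"
    using xyzw by (metis inv_solve_right m_closed)
  also have "z \<otimes> w \<otimes> inv y = w \<otimes> inv y \<otimes> z"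
    using xyzw by (simp add: m_ac)
  also have "x = w \<otimes> inv y \<otimes> z \<longleftrightarrow> x \<otimes> inv z = w \<otimes> inv y"
    using xyzw inv_solve_right[of "w \<otimes> inv y" x z] by auto
  finally show "frag_inner (bilinear_extension (\<otimes>) (frag_of x) (frag_of y))
      (bilinear_extension (\<otimes>) (frag_of z) (frag_of w)) =
    frag_inner (bilinear_extension (\<lambda>x y. x \<otimes> inv y) (frag_of x) (frag_of z))
      (bilinear_extension (\<lambda>x y. x \<otimes> inv y) (frag_of w) (frag_of y))"
    by simp
qed (simp_all add: bilinear_extension_diff frag_inner_diff)

text \<open>Only the pairs with x = y contribute to the coefficient at the neutral element.\<close>

lemma lookup_one_div_eq_frag_inner:
  assumes "Poly_Mapping.keys a \<subseteq> carrier G" "Poly_Mapping.keys b \<subseteq> carrier G"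
  shows "Poly_Mapping.lookup (bilinear_extension (\<lambda>x y. x \<otimes> inv y) a b) \<one> = frag_inner a b"
  using assms(1)
proof (induction a rule: frag_induction)
  case (one x)
  show ?case
    using assms(2)
  proof (induction b rule: frag_induction)
    case (one y)
    then have "\<one> = x \<otimes> inv y \<longleftrightarrow> x = y"
      using \<open>x \<in> carrier G\<close> by (metis inv_closed inv_inv inv_equality r_inv)
    then show ?case by (simp only: bilinear_extension_of lookup_frag_of frag_inner_of)
  qed (simp_all add: bilinear_extension_diff frag_inner_diff lookup_minus)
qed (simp_all add: bilinear_extension_diff frag_inner_diff lookup_minus)

lemma frag_inner_square_ge:
  assumes "Poly_Mapping.keys a \<subseteq> carrier G"
  shows "(frag_inner a a)\<^sup>2 \<le>
    frag_inner (bilinear_extension (\<otimes>) a a) (bilinear_extension (\<otimes>) a a)"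
  using lookup_power2_le_frag_inner[of "bilinear_extension (\<lambda>x y. x \<otimes> inv y) a a" \<one>] assms
  by (simp add: frag_inner_mult_eq lookup_one_div_eq_frag_inner)

lemma quandle_ring_idempotent_square:
  assumes "f \<in> hom G G" and u: "quandle_ring_idempotent (affine_quandle G f) u"
  shows "quandle_ring_idempotent (affine_quandle G f) (bilinear_extension (\<otimes>) u u)"
proof -
  interpret group_hom G G f
    by unfold_locales (rule assms(1))
  let ?q = "qop (affine_quandle G f)"
  have keys: "Poly_Mapping.keys u \<subseteq> carrier G" and idem: "bilinear_extension ?q u u = u"
    using u by (auto simp: quandle_ring_idempotent_def quandle_ring_carrier_def
        affine_quandle_def quandle_ring_mult_eq)
  \<comment> \<open>Since \<open>f\<close> is a homomorphism and the group is abelian, both sides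
    are products of the same factors.\<close>
  have "?q (x \<otimes> y) (z \<otimes> w) = ?q x z \<otimes> ?q y w"
    if "x \<in> carrier G" "y \<in> carrier G" "z \<in> carrier G" "w \<in> carrier G" for x y z w
    using that by (simp add: affine_quandle_def inv_mult m_ac)
  then have "bilinear_extension ?q (bilinear_extension (\<otimes>) u u) (bilinear_extension (\<otimes>) u u) =
      bilinear_extension (\<otimes>) (bilinear_extension ?q u u) (bilinear_extension ?q u u)"
    by (intro bilinear_extension_interchange[OF keys keys keys keys]) auto
  moreover have "Poly_Mapping.keys (bilinear_extension (\<otimes>) u u) \<subseteq> carrier G"
    by (rule keys_bilinear_extension_subset[OF keys keys]) simp
  \<comment> \<open>\<open>affine_quandle\<close> is unfolded only in the second call, so that the
    interchange equation still matches in the first.\<close>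
  ultimately show ?thesis
    by (simp add: quandle_ring_idempotent_def quandle_ring_carrier_def quandle_ring_mult_eq idem)
      (simp add: affine_quandle_def)
qed

lemma infinite_nontrivial_idempotents:
  assumes "f \<in> hom G G" "nontrivial_idempotent (affine_quandle G f) u" "augmentation u = 1"
  shows "infinite {v. nontrivial_idempotent (affine_quandle G f) v}"
proof -
  let ?Q = "affine_quandle G f"
  have keys: "Poly_Mapping.keys v \<subseteq> carrier G" if "quandle_ring_idempotent ?Q v" for v
    using that by (simp add: quandle_ring_idempotent_def quandle_ring_carrier_def affine_quandle_def)
  have u: "quandle_ring_idempotent ?Q u" "\<not> trivial_idempotent ?Q u"
    using assms(2) by (auto simp: nontrivial_idempotent_def)
  have u2: "frag_inner u u \<ge> 2"
  proof (rule frag_inner_ge_2_if_augmentation_1[OF assms(3)])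
    fix x assume "x \<in> Poly_Mapping.keys u"
    then show "u \<noteq> frag_of x"
      using keys[OF u(1)] u(2) by (auto simp: trivial_idempotent_def affine_quandle_def)
  qed
  \<comment> \<open>In the group ring, \<open>s k\<close> is the power of \<open>u\<close> with
    exponent \<open>2 ^ k\<close>.\<close>
  define s where "s k = ((\<lambda>v. bilinear_extension (\<otimes>) v v) ^^ k) u" for k
  \<comment> \<open>A linear bound is enough for unboundedness; its start at 2 lets squaring raise
    it at each step and keeps every \<open>s k\<close> apart from the trivial idempotents.\<close>
  have s: "quandle_ring_idempotent ?Q (s k) \<and> frag_inner (s k) (s k) \<ge> int k + 2" for k
  proof (induction k)
    case 0
    then show ?case using u u2 by (simp add: s_def)
  next
    case (Suc k)
    have "int (Suc k) + 2 \<le> (int k + 2)\<^sup>2"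
      by (simp add: power2_eq_square algebra_simps)
    also have "\<dots> \<le> (frag_inner (s k) (s k))\<^sup>2"
      using Suc by (intro power_mono) auto
    also have "\<dots> \<le> frag_inner (s (Suc k)) (s (Suc k))"
      using frag_inner_square_ge[OF keys] Suc by (simp add: s_def)
    finally show ?case
      using quandle_ring_idempotent_square[OF assms(1)] Suc by (simp add: s_def)
  qed
  \<comment> \<open>N is 0 at \<open>0\<close> and 1 at basis elements, but at least 2 at
    \<open>s k\<close>.\<close>
  have nontrivial: "nontrivial_idempotent ?Q (s k)" for k
    using s[of k] by (auto simp: nontrivial_idempotent_def trivial_idempotent_def)
  show ?thesis
  proof
    assume "finite {v. nontrivial_idempotent ?Q v}"
    \<comment> \<open>Unboundedness of N on the idempotents replaces a proof that the
      \<open>s k\<close> are distinct.\<close>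
    then have "bdd_above ((\<lambda>v. frag_inner v v) ` {v. nontrivial_idempotent ?Q v})"
      by simp
    then obtain b where b: "\<And>v. nontrivial_idempotent ?Q v \<Longrightarrow> frag_inner v v \<le> b"
      unfolding bdd_above_def by auto
    show False
      \<comment> \<open>At index \<open>nat b\<close> the norm is at least
        \<open>int (nat b) + 2\<close>, which exceeds \<open>b\<close> even if \<open>b\<close> is
        negative.\<close>
      using b[OF nontrivial[of "nat b"]] s[of "nat b"] by linarith
  qed
qed

end

theorem theorem4p2:
  fixes p :: nat and f :: "int \<Rightarrow> int" and Q :: "int quandle" and u :: "int \<Rightarrow>\<^sub>0 int"
  assumes "Factorial_Ring.prime p"
    and "f \<in> auto (integer_mod_group p)"
    and "Q = affine_quandle (integer_mod_group p) f"
    and "connected_quandle Q"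
    and "nontrivial_idempotent Q u"
    and "augmentation u = 1"
  shows "infinite {v. nontrivial_idempotent Q v}"
proof -
  interpret comm_group "integer_mod_group p"
    by (rule abelian_integer_mod_group)
  show ?thesis
    using assms infinite_nontrivial_idempotents by (simp add: auto_def)
qed

end
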